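(* As $n$ tends to infinity, the number of primes in the interval $[3n, 4n]$ goes to infinity. In other words, for every positive integer $m$, there exists a positive integer $L$ such that for all integers $n \ge L$, there are at least $m$ primes $p$ with $3n \le p \le 4n$. *)

theory Defs
  imports Complex_Main "HOL-Computational_Algebra.Primes"
begin

end

theory Submission
  imports
    Defs
    "HOL-Number_Theory.Prime_Powers"
    "HOL-Real_Asymp.Real_Asymp"
begin

text \<open>
  The proof is Chebyshev's. Write \<open>\<psi>(n)\<close> for the sum of the von Mangoldt function over
  \<open>1, \<dots>, n\<close> and consider \<open>E(N) = ln N! + ln (N/30)! - ln (N/2)! - ln (N/3)! - ln (N/5)!\<close>,
  with all quotients rounded down. Stirling's formula evaluates it as \<open>A N\<close> up to an error
  of order \<open>ln N\<close>, where \<open>A > 0\<close> is a constant: since \<open>1 + 1/30 = 1/2 + 1/3 + 1/5\<close>, the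
  terms \<open>N ln N\<close> cancel.

  On the other hand \<open>ln n! = \<Sum>\<^sub>d \<Lambda>(d) \<lfloor>n/d\<rfloor>\<close> writes \<open>E(N)\<close> as a sum of \<open>\<Lambda>(d)\<close> with
  coefficients that are always 0 or 1, and are 1 for \<open>d > N/6\<close>. Hence
  \<open>\<psi>(N) - \<psi>(N/6) \<le> E(N) \<le> \<psi>(N)\<close>. The right inequality gives \<open>\<psi>(N) \<ge> A N - O(\<surd>N)\<close>
  (lemma \<open>chebyshev_psi_lower\<close>). Iterating the left one gives
  \<open>\<psi>(N) \<le> A N (1 + 1/6 + 1/36 + \<dots>) + O(\<surd>N) = (6/5) A N + O(\<surd>N)\<close>
  (lemma \<open>chebyshev_psi_upper\<close>).

  The ratio 6/5 of the two bounds is smaller than 4/3, which is all that the interval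
  from \<open>3n\<close> to \<open>4n\<close> requires:
  \<open>\<psi>(4n) - \<psi>(3n) \<ge> (4 - 18/5) A n - O(\<surd>n) = (2/5) A n - O(\<surd>n)\<close>. Each prime power in the
  interval contributes at most \<open>ln (4n)\<close> to this difference, and at most \<open>2 \<surd>n\<close> of
  them are not primes (lemma \<open>psi_diff_le_card_primes\<close>), so the number of primes is at
  least \<open>((2/5) A n - O(\<surd>n)) / ln (4n) - 2 \<surd>n\<close>, which tends to infinity.
\<close>

section \<open>Factorials and their logarithms\<close>

definition stirling_main :: "real \<Rightarrow> real" where
  "stirling_main x = x * ln x - x"

text \<open>
  The graph of the convex function \<open>x ln x - x\<close> lies above its tangents, whose slope at
  \<open>x\<close> is \<open>ln x\<close>. The estimates of \<open>ln n!\<close> below all rest on this inequality.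
\<close>
lemma stirling_main_above_tangent:
  assumes "x > 0" "y > 0"
  shows "stirling_main x + (y - x) * ln x \<le> stirling_main y"
proof -
  have "y * ln (x / y) \<le> y * (x / y - 1)"
    using assms by (intro mult_left_mono ln_le_minus_one) auto
  also have "\<dots> = x - y"
    using assms by (simp add: field_simps)
  finally show ?thesis
    using assms by (simp add: stirling_main_def ln_div algebra_simps)
qed

text \<open>
  By the tangents at \<open>m\<close> and \<open>m + 1\<close>, the step from \<open>m\<close> to \<open>m + 1\<close> increases the main term
  by an amount between \<open>ln m\<close> and \<open>ln (m + 1)\<close>, while \<open>ln m!\<close> increases by \<open>ln (m + 1)\<close>.
  The constant 1 makes the bounds sharp at \<open>m = 1\<close>.
\<close>
lemma ln_fact_bounds:
  assumes "m > 0"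
  shows "stirling_main (real m) + 1 \<le> ln (fact m)"
    and "ln (fact m) \<le> stirling_main (real m) + 1 + ln (real m)"
proof -
  have "stirling_main (real m) + 1 \<le> ln (fact m) \<and>
        ln (fact m) \<le> stirling_main (real m) + 1 + ln (real m)"
    using assms
  proof (induction m rule: nat_induct_non_zero)
    case 1
    then show ?case by (simp add: stirling_main_def)
  next
    case (Suc m)
    have "ln (fact (Suc m) :: real) = ln (real (Suc m)) + ln (fact m)"
      by (simp add: ln_mult del: of_nat_Suc)
    moreover have "stirling_main (real (Suc m)) - ln (real (Suc m)) \<le> stirling_main (real m)"
      using stirling_main_above_tangent[of "real (Suc m)" "real m"] Suc.hyps by simp
    moreover have "stirling_main (real m) + ln (real m) \<le> stirling_main (real (Suc m))"
      using stirling_main_above_tangent[of "real m" "real (Suc m)"] Suc.hyps by simp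
    ultimately show ?case using Suc.IH by linarith
  qed
  then show "stirling_main (real m) + 1 \<le> ln (fact m)"
    and "ln (fact m) \<le> stirling_main (real m) + 1 + ln (real m)" by auto
qed

text \<open>
  Rounding \<open>N/k\<close> down changes the main term by at most its slope \<open>ln (N/k)\<close>.
\<close>
lemma ln_fact_div_approx:
  assumes "k > 0" "k \<le> N"
  shows "\<bar>ln (fact (N div k)) - stirling_main (real N / real k)\<bar> \<le> 1 + ln (real N)"
proof -
  define m where "m = N div k"
  define x where "x = real N / real k"
  have m: "m > 0" using assms by (simp add: m_def div_greater_zero_iff)
  have "real m = of_int \<lfloor>x\<rfloor>"
    unfolding m_def x_def floor_divide_of_nat_eq by simp
  then have mx: "real m \<le> x" "x < real m + 1" by linarith+
  have x1: "x \<ge> 1" using mx m by linarith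
  have xN: "ln x \<le> ln (real N)"
  proof -
    have "x \<le> real N" using assms by (simp add: x_def field_simps mult_le_cancel_left1)
    then show ?thesis using x1 by simp
  qed
  have "stirling_main x - ln x \<le> stirling_main (real m)"
  proof -
    have "- 1 * ln x \<le> (real m - x) * ln x"
      using mx x1 by (intro mult_right_mono) auto
    then show ?thesis
      using stirling_main_above_tangent[of x "real m"] m x1 by simp
  qed
  moreover have "stirling_main (real m) \<le> stirling_main x"
  proof -
    have "0 \<le> (x - real m) * ln (real m)" using mx m by simp
    then show ?thesis
      using stirling_main_above_tangent[of "real m" x] m x1 by simp
  qed
  moreover have "ln (real m) \<le> ln x" using mx m by simp
  moreover have "ln (real m) \<ge> 0" using m by simp
  ultimately show ?thesis
    using ln_fact_bounds[OF m] xN unfolding m_def[symmetric] x_def[symmetric] by linarith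
qed

text \<open>
  Sum \<open>ln j = \<Sum>\<^bsub>d dvd j\<^esub> \<Lambda>(d)\<close> over \<open>j \<le> n\<close>: exactly \<open>n div d\<close> of these \<open>j\<close> are multiples
  of \<open>d\<close>. The range of summation may be longer than \<open>n\<close>, so that the factorials in Chebyshev's
  quotient can all be expanded over the same range.
\<close>
lemma ln_fact_eq_sum_mangoldt:
  assumes "n \<le> M"
  shows "ln (fact n) = (\<Sum>d=1..M. mangoldt d * real (n div d))"
  using assms
proof (induction n)
  case 0
  then show ?case by simp
next
  case (Suc n)
  have "(\<Sum>d=1..M. mangoldt d * real (Suc n div d)) =
        (\<Sum>d=1..M. mangoldt d * real (n div d) + (if d dvd Suc n then mangoldt d else 0))"
    by (intro sum.cong) (auto simp: div_Suc dvd_eq_mod_eq_0 algebra_simps)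
  also have "\<dots> = ln (fact n) + (\<Sum>d=1..M. if d dvd Suc n then mangoldt d else 0)"
    using Suc by (simp add: sum.distrib)
  also have "(\<Sum>d=1..M. if d dvd Suc n then mangoldt d else 0) =
             (\<Sum>d | d dvd Suc n. mangoldt d :: real)"
  proof -
    have "d \<in> {1..M}" if "d dvd Suc n" for d
      using that Suc.prems dvd_imp_le[OF that] by (cases d) auto
    then have "{d \<in> {1..M}. d dvd Suc n} = {d. d dvd Suc n}" by blast
    then show ?thesis
      using sum.inter_filter[of "{1..M}" "mangoldt :: nat \<Rightarrow> real" "\<lambda>d. d dvd Suc n"]
      by (simp only: finite_atLeastAtMost)
  qed
  also have "\<dots> = ln (real (Suc n))"
    using mangoldt_sum[of "Suc n", where ?'a = real] by simp
  also have "ln (fact n) + ln (real (Suc n)) = ln (fact (Suc n))"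
    by (simp add: ln_mult add.commute del: of_nat_Suc)
  finally show ?case ..
qed

section \<open>The second Chebyshev function\<close>

definition chebyshev_psi :: "nat \<Rightarrow> real" where
  "chebyshev_psi n = (\<Sum>d=1..n. mangoldt d)"

lemma chebyshev_psi_mono: "m \<le> n \<Longrightarrow> chebyshev_psi m \<le> chebyshev_psi n"
  unfolding chebyshev_psi_def by (intro sum_mono2) (auto simp: mangoldt_nonneg)

text \<open>
  The logarithm of \<open>N! (N/30)! / ((N/2)! (N/3)! (N/5)!)\<close> with rounded quotients; when \<open>N\<close>
  is a multiple of 30, this is an integer although no product of multinomial coefficients.
\<close>
definition chebyshev_quotient_ln :: "nat \<Rightarrow> real" where
  "chebyshev_quotient_ln N = ln (fact N) + ln (fact (N div 30))
     - ln (fact (N div 2)) - ln (fact (N div 3)) - ln (fact (N div 5))"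

text \<open>
  The coefficient of \<open>\<Lambda>(d)\<close> in the expansion of the quotient, as a function of \<open>m = N div d\<close>.
\<close>
definition chebyshev_coeff :: "nat \<Rightarrow> int" where
  "chebyshev_coeff m = int m + int (m div 30) - int (m div 2) - int (m div 3) - int (m div 5)"

text \<open>
  The coefficient has period 30 because \<open>30 + 1 = 15 + 10 + 6\<close>; its bounds are therefore a
  finite check.
\<close>
lemma chebyshev_coeff_mod: "chebyshev_coeff m = chebyshev_coeff (m mod 30)"
proof -
  define q r where "q = m div 30" and "r = m mod 30"
  have "m = 30 * q + r" by (simp add: q_def r_def)
  moreover have "(30 * q + r) div 2 = 15 * q + r div 2"
    "(30 * q + r) div 3 = 10 * q + r div 3"
    "(30 * q + r) div 5 = 6 * q + r div 5"
    "(30 * q + r) div 30 = q + r div 30" by presburger+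
  ultimately show ?thesis unfolding chebyshev_coeff_def r_def[symmetric] by simp
qed

lemma chebyshev_coeff_bounds: "0 \<le> chebyshev_coeff m" "chebyshev_coeff m \<le> 1"
proof -
  have "\<forall>r\<in>{..<30}. 0 \<le> chebyshev_coeff r \<and> chebyshev_coeff r \<le> 1"
    by (simp add: chebyshev_coeff_def lessThan_nat_numeral lessThan_Suc)
  moreover have "m mod 30 \<in> {..<30}" by simp
  ultimately have "0 \<le> chebyshev_coeff (m mod 30) \<and> chebyshev_coeff (m mod 30) \<le> 1" by blast
  then show "0 \<le> chebyshev_coeff m" "chebyshev_coeff m \<le> 1"
    unfolding chebyshev_coeff_mod[of m, symmetric] by auto
qed

lemma chebyshev_coeff_eq_1:
  assumes "0 < m" "m < 6"
  shows "chebyshev_coeff m = 1"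
proof -
  have "m \<in> {1, 2, 3, 4, 5}" using assms by auto
  then show ?thesis by (auto simp: chebyshev_coeff_def)
qed

lemma chebyshev_quotient_ln_eq_sum:
  "chebyshev_quotient_ln N = (\<Sum>d=1..N. mangoldt d * of_int (chebyshev_coeff (N div d)))"
proof -
  \<comment> \<open>All five factorials then involve \<open>d\<close> through \<open>N div d\<close> alone.\<close>
  have *: "N div k div d = N div d div k" for k d
    by (simp add: div_mult2_eq[symmetric] mult.commute)
  show ?thesis
    unfolding chebyshev_quotient_ln_def
    by (simp add: ln_fact_eq_sum_mangoldt[of _ N] * chebyshev_coeff_def algebra_simps
          sum.distrib sum_subtractf)
qed

lemma chebyshev_quotient_ln_le_psi: "chebyshev_quotient_ln N \<le> chebyshev_psi N"
proof -
  have "mangoldt d * of_int (chebyshev_coeff (N div d)) \<le> (mangoldt d :: real)" for d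
    using mult_left_mono[of "of_int (chebyshev_coeff (N div d))" 1 "mangoldt d :: real"]
      chebyshev_coeff_bounds[of "N div d"] mangoldt_nonneg[of d] by simp
  then show ?thesis
    unfolding chebyshev_quotient_ln_eq_sum chebyshev_psi_def by (intro sum_mono)
qed

text \<open>
  The coefficient is 1 whenever \<open>N div d < 6\<close>, that is, for \<open>d > N div 6\<close>; so the quotient
  accounts for everything that \<open>\<psi>(N div 6)\<close> leaves out.
\<close>
lemma psi_le_psi_div_6_plus_quotient:
  "chebyshev_psi N \<le> chebyshev_psi (N div 6) + chebyshev_quotient_ln N"
proof -
  have "chebyshev_psi N \<le>
        (\<Sum>d=1..N. (if d \<in> {1..N div 6} then mangoldt d else 0)
                    + mangoldt d * of_int (chebyshev_coeff (N div d)))"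
    unfolding chebyshev_psi_def
  proof (intro sum_mono)
    fix d assume d: "d \<in> {1..N}"
    show "mangoldt d \<le> (if d \<in> {1..N div 6} then mangoldt d else 0)
             + mangoldt d * real_of_int (chebyshev_coeff (N div d))"
    proof (cases "d \<le> N div 6")
      case True
      then show ?thesis
        using d chebyshev_coeff_bounds[of "N div d"] mangoldt_nonneg[of d] by simp
    next
      case False
      then have "N < 6 * d" by linarith
      then have "N div d < 6" using d by (simp add: div_less_iff_less_mult)
      moreover have "N div d > 0" using d by (simp add: div_greater_zero_iff)
      ultimately show ?thesis using False by (simp add: chebyshev_coeff_eq_1)
    qed
  qed
  also have "\<dots> = (\<Sum>d\<in>{1..N} \<inter> {1..N div 6}. mangoldt d) + chebyshev_quotient_ln N"
    by (simp only: sum.distrib chebyshev_quotient_ln_eq_sum sum.inter_restrict finite_atLeastAtMost)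
  also have "{1..N} \<inter> {1..N div 6} = {1..N div 6}" by auto
  finally show ?thesis by (simp add: chebyshev_psi_def)
qed

text \<open>
  Chebyshev's constant, about \<open>0.92129\<close>. Both bounds for \<open>\<psi>\<close> are proportional to it, so
  comparing them requires only that it is positive.
\<close>
definition chebyshev_const :: real where
  "chebyshev_const = ln 2 / 2 + ln 3 / 3 + ln 5 / 5 - ln 30 / 30"

lemma chebyshev_const_pos: "chebyshev_const > 0"
proof -
  have "ln 30 = ln (2 * 3 * 5 :: real)" by simp
  also have "\<dots> = ln 2 + ln 3 + ln 5" by (simp only: ln_mult_pos zero_less_numeral mult_pos_pos)
  finally have "chebyshev_const = 14 / 30 * ln 2 + 9 / 30 * ln 3 + 5 / 30 * ln 5"
    by (simp add: chebyshev_const_def field_simps)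
  also have "\<dots> > 0" by (intro add_pos_pos mult_pos_pos) auto
  finally show ?thesis .
qed

text \<open>
  Each of the five factorials contributes an error of at most \<open>1 + ln N\<close>. The cruder error
  term \<open>\<surd>N\<close> is preferred to \<open>ln N\<close> because it shrinks by a constant factor
  when \<open>N\<close> is divided by 6, and so survives the recursion for \<open>\<psi>\<close> without growing.
\<close>
lemma chebyshev_quotient_ln_approx:
  assumes "N \<ge> 30"
  shows "\<bar>chebyshev_quotient_ln N - chebyshev_const * N\<bar> \<le> 10 * sqrt N"
proof -
  define h where "h k = stirling_main (real N / real k)" for k :: nat
  have N: "real N > 0" using assms by simp
  have err: "\<bar>ln (fact (N div k)) - h k\<bar> \<le> 1 + ln (real N)" if "k > 0" "k \<le> 30" for k
    unfolding h_def using that assms by (intro ln_fact_div_approx) auto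
  have "h 1 + h 30 - h 2 - h 3 - h 5 = chebyshev_const * N"
    using N by (simp add: h_def stirling_main_def chebyshev_const_def ln_div field_simps)
  then have "\<bar>chebyshev_quotient_ln N - chebyshev_const * N\<bar> \<le> 5 * (1 + ln (real N))"
    using err[of 1, simplified] err[of 30] err[of 2] err[of 3] err[of 5]
    unfolding chebyshev_quotient_ln_def abs_le_iff One_nat_def by simp
  also have "ln (real N) \<le> 2 * sqrt N - 2"
    using ln_le_minus_one[of "sqrt N"] N by (simp add: ln_sqrt)
  finally show ?thesis by simp
qed

lemma chebyshev_psi_lower:
  assumes "N \<ge> 30"
  shows "chebyshev_const * N - 10 * sqrt N \<le> chebyshev_psi N"
  using chebyshev_quotient_ln_approx[OF assms] chebyshev_quotient_ln_le_psi[of N] by linarith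

text \<open>
  Induction along \<open>N \<mapsto> N div 6\<close>. The main term reproduces itself as \<open>6/5 = 1 + (6/5)/6\<close>. For
  the error term, \<open>\<surd>(N/6) \<le> \<surd>N / 2\<close> leaves \<open>C/2\<close> to absorb the error 10 of one step.
\<close>
lemma chebyshev_psi_upper:
  "\<exists>C\<ge>0. \<forall>N. chebyshev_psi N \<le> 6 / 5 * chebyshev_const * N + C * sqrt N"
proof -
  \<comment> \<open>The value 20 serves the induction step, the other one all \<open>N < 30\<close>.\<close>
  define C where "C = max 20 (chebyshev_psi 30)"
  have C: "C \<ge> 20" "C \<ge> chebyshev_psi 30" by (auto simp: C_def)
  have "chebyshev_psi N \<le> 6 / 5 * chebyshev_const * N + C * sqrt N" for N
  proof (induction N rule: less_induct)
    case (less N)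
    consider "N = 0" | "0 < N" "N < 30" | "N \<ge> 30" by linarith
    then show ?case
    proof cases
      case 1
      then show ?thesis by (simp add: chebyshev_psi_def)
    next
      case 2
      have "chebyshev_psi N \<le> C * 1"
        using chebyshev_psi_mono[of N 30] 2 C by simp
      also have "\<dots> \<le> C * sqrt N"
        using 2 C by (intro mult_left_mono) auto
      finally show ?thesis
        using chebyshev_const_pos by (simp add: add_increasing)
    next
      case 3
      have N6: "real (N div 6) \<le> real N / 6"
      proof -
        have "real (6 * (N div 6)) \<le> real N" by (intro of_nat_mono) simp
        then show ?thesis by simp
      qed
      have "sqrt (real (N div 6)) \<le> sqrt (real N / 4)"
        using N6 by (intro real_sqrt_le_mono) simp
      also have "\<dots> = sqrt N / 2" by (simp add: real_sqrt_divide)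
      finally have "C * sqrt (real (N div 6)) \<le> C * (sqrt N / 2)"
        using C by (intro mult_left_mono) auto
      then have "C * sqrt (real (N div 6)) \<le> C * sqrt N / 2" by simp
      moreover have "6 / 5 * chebyshev_const * real (N div 6) \<le> chebyshev_const * N / 5"
        using N6 chebyshev_const_pos by simp
      moreover have "10 * sqrt N \<le> C * sqrt N / 2"
        using C mult_right_mono[of 20 C "sqrt N"] by simp
      moreover have "chebyshev_psi (N div 6) \<le>
          6 / 5 * chebyshev_const * real (N div 6) + C * sqrt (real (N div 6))"
        using 3 by (intro less.IH) simp
      moreover have "6 / 5 * chebyshev_const * N = chebyshev_const * N + chebyshev_const * N / 5"
        by simp
      ultimately show ?thesis
        using psi_le_psi_div_6_plus_quotient[of N] chebyshev_quotient_ln_approx[OF 3]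
        by linarith
    qed
  qed
  moreover have "C \<ge> 0" using C by simp
  ultimately show ?thesis by blast
qed

section \<open>From weighted prime powers to primes\<close>

lemma card_squares_le: "real (card {p::nat. 0 < p \<and> p ^ 2 \<le> N}) \<le> sqrt N"
proof -
  have "{p::nat. 0 < p \<and> p ^ 2 \<le> N} \<subseteq> {1..nat \<lfloor>sqrt N\<rfloor>}"
  proof
    fix p :: nat assume p: "p \<in> {p. 0 < p \<and> p ^ 2 \<le> N}"
    then have "real p ^ 2 \<le> real N" by (metis mem_Collect_eq of_nat_le_iff of_nat_power)
    then have "real p \<le> sqrt N" by (rule real_le_rsqrt)
    then show "p \<in> {1..nat \<lfloor>sqrt N\<rfloor>}" using p by (auto simp: le_nat_iff le_floor_iff)
  qed
  then have "card {p::nat. 0 < p \<and> p ^ 2 \<le> N} \<le> nat \<lfloor>sqrt N\<rfloor>"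
    using card_mono[of "{1..nat \<lfloor>sqrt N\<rfloor>}"] by simp
  then have "real (card {p::nat. 0 < p \<and> p ^ 2 \<le> N}) \<le> real (nat \<lfloor>sqrt N\<rfloor>)"
    by (rule of_nat_mono)
  also have "\<dots> \<le> sqrt N" by simp
  finally show ?thesis .
qed

text \<open>
  An interval that does not reach beyond the double of its excluded left end contains at most
  one power of each prime, so proper prime powers \<open>p ^ k\<close> in it are determined by \<open>p\<close>. Since
  \<open>k \<ge> 2\<close>, the base satisfies \<open>p\<^sup>2 \<le> b\<close>.
\<close>
lemma card_proper_primepows_le:
  fixes a b :: nat
  assumes "b \<le> 2 * a"
  shows "real (card {d\<in>{a<..b}. primepow d \<and> \<not> prime d}) \<le> sqrt b"
proof -
  let ?A = "{d\<in>{a<..b}. primepow d \<and> \<not> prime d}"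
  have decomp: "\<exists>p k. prime p \<and> k \<ge> 2 \<and> d = p ^ k \<and> aprimedivisor d = p" if d: "d \<in> ?A" for d
  proof -
    obtain p k where pk: "prime p" "k > 0" "d = p ^ k"
      using d by (auto simp: primepow_def)
    moreover have "k \<noteq> 1" using d pk by auto
    moreover have "aprimedivisor d = p" using pk by (simp add: aprimedivisor_prime_power)
    ultimately show ?thesis by (intro exI[of _ p] exI[of _ k]) simp
  qed
  have "inj_on aprimedivisor ?A"
  proof (rule linorder_inj_onI')
    fix d e assume de: "d \<in> ?A" "e \<in> ?A" "d < e"
    show "aprimedivisor d \<noteq> aprimedivisor e"
    proof
      assume eq: "aprimedivisor d = aprimedivisor e"
      obtain p k l where p: "prime p" "d = p ^ k" "e = p ^ l"
        using decomp[OF de(1)] decomp[OF de(2)] eq by metis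
      have p2: "p \<ge> 2" using p(1) by (rule prime_ge_2_nat)
      have "k < l" using de(3) p p2 by simp
      then have "p ^ Suc k \<le> p ^ l" using p2 by (intro power_increasing) auto
      moreover have "2 * p ^ k \<le> p ^ Suc k" using p2 by simp
      ultimately have "2 * d \<le> e" using p by linarith
      then show False using de assms by auto
    qed
  qed
  moreover have "aprimedivisor ` ?A \<subseteq> {p. 0 < p \<and> p ^ 2 \<le> b}"
  proof (rule image_subsetI)
    fix d assume d: "d \<in> ?A"
    then obtain p k where p: "prime p" "k \<ge> 2" "d = p ^ k" "aprimedivisor d = p"
      using decomp by blast
    have "p ^ 2 \<le> p ^ k" using p prime_gt_0_nat[OF p(1)] by (intro power_increasing) auto
    then show "aprimedivisor d \<in> {p. 0 < p \<and> p ^ 2 \<le> b}"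
      using d p prime_gt_0_nat[OF p(1)] by auto
  qed
  moreover have "finite {p. 0 < p \<and> p ^ 2 \<le> b}"
  proof (rule finite_subset)
    show "{p. 0 < p \<and> p ^ 2 \<le> b} \<subseteq> {..b}"
      using power2_nat_le_imp_le by blast
  qed (rule finite_atMost)
  ultimately have "card ?A \<le> card {p::nat. 0 < p \<and> p ^ 2 \<le> b}"
    by (intro card_inj_on_le)
  then show ?thesis using card_squares_le[of b] by linarith
qed

text \<open>
  The difference is a sum over the prime powers in the interval, each of weight at most \<open>ln b\<close>.
\<close>
lemma psi_diff_le_card_primes:
  fixes a b :: nat
  assumes "a \<le> b" "b \<le> 2 * a"
  shows "chebyshev_psi b - chebyshev_psi a
           \<le> (real (card {p. prime p \<and> a \<le> p \<and> p \<le> b}) + sqrt b) * ln b"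
proof (cases "b = 0")
  case True
  then show ?thesis using assms by (simp add: chebyshev_psi_def)
next
  case False
  let ?P = "{p. prime p \<and> a \<le> p \<and> p \<le> b}"
  let ?Q = "{d\<in>{a<..b}. primepow d \<and> \<not> prime d}"
  have fin: "finite ?P" by (rule finite_subset[of _ "{..b}"]) auto
  have "{1..b} = {1..a} \<union> {a<..b}" using assms by auto
  then have "chebyshev_psi b = chebyshev_psi a + (\<Sum>d\<in>{a<..b}. mangoldt d)"
    unfolding chebyshev_psi_def by (simp only:) (rule sum.union_disjoint; auto)
  also have "(\<Sum>d\<in>{a<..b}. mangoldt d :: real) = (\<Sum>d | d \<in> {a<..b} \<and> primepow d. mangoldt d)"
    by (intro sum.mono_neutral_right) (auto simp: mangoldt_def)
  also have "(\<Sum>d | d \<in> {a<..b} \<and> primepow d. mangoldt d :: real) \<le> (\<Sum>d\<in>?P \<union> ?Q. mangoldt d)"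
    using fin by (intro sum_mono2) (auto simp: mangoldt_nonneg)
  also have "(\<Sum>d\<in>?P \<union> ?Q. mangoldt d :: real) \<le> (\<Sum>d\<in>?P \<union> ?Q. ln (real b))"
  proof (rule sum_mono)
    fix d assume d: "d \<in> ?P \<union> ?Q"
    then have "d > 0" using prime_gt_0_nat by auto
    then have "mangoldt d \<le> ln (real d)" by (rule mangoldt_le)
    also have "\<dots> \<le> ln (real b)" using d \<open>d > 0\<close> by auto
    finally show "mangoldt d \<le> ln (real b)" .
  qed
  also have "\<dots> = real (card (?P \<union> ?Q)) * ln b" by simp
  also have "\<dots> \<le> (real (card ?P) + sqrt b) * ln b"
  proof (rule mult_right_mono)
    have "card (?P \<union> ?Q) \<le> card ?P + card ?Q" by (rule card_Un_le)
    then show "real (card (?P \<union> ?Q)) \<le> real (card ?P) + sqrt b"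
      using card_proper_primepows_le[OF assms(2)] by linarith
    show "0 \<le> ln (real b)" using False by simp
  qed
  finally show ?thesis by simp
qed

section \<open>Primes between three and four times a number\<close>

theorem theorem2p4:
  shows "filterlim (\<lambda>n::nat. card {p::nat. prime p \<and> 3 * n \<le> p \<and> p \<le> 4 * n}) at_top at_top
    \<and> (\<forall>m::nat. m > 0 \<longrightarrow> (\<exists>L::nat. L > 0 \<and>
          (\<forall>n\<ge>L. card {p::nat. prime p \<and> 3 * n \<le> p \<and> p \<le> 4 * n} \<ge> m)))"
proof -
  define P where "P n = card {p::nat. prime p \<and> 3 * n \<le> p \<and> p \<le> 4 * n}" for n
  obtain C where C: "C \<ge> 0"
    "chebyshev_psi N \<le> 6 / 5 * chebyshev_const * N + C * sqrt N" for N
    using chebyshev_psi_upper by blast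
  define c where "c = 2 / 5 * chebyshev_const"
  have c: "c > 0" using chebyshev_const_pos by (simp add: c_def)
  \<comment> \<open>\<open>10 \<surd>(4n) = 20 \<surd>n\<close> from the lower bound at \<open>4n\<close>, \<open>C \<surd>(3n)\<close> from the upper bound at \<open>3n\<close>.\<close>
  define K where "K = 20 + C * sqrt 3"
  have lower: "(c * n - K * sqrt n) / ln (4 * n) - 2 * sqrt n \<le> real (P n)" if n: "n \<ge> 30" for n :: nat
  proof -
    have ln: "ln (4 * real n) > 0" using n by (intro ln_gt_zero) auto
    have "c * n - K * sqrt n \<le> chebyshev_psi (4 * n) - chebyshev_psi (3 * n)"
      using chebyshev_psi_lower[of "4 * n"] C(2)[of "3 * n"] n
      by (simp add: c_def K_def real_sqrt_mult algebra_simps)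
    also have "\<dots> \<le> (real (P n) + 2 * sqrt n) * ln (4 * n)"
      using psi_diff_le_card_primes[of "3 * n" "4 * n"] by (simp add: P_def real_sqrt_mult)
    finally show ?thesis using ln by (simp add: field_simps)
  qed
  have "filterlim (\<lambda>n::nat. (c * n - K * sqrt n) / ln (4 * n) - 2 * sqrt n) at_top at_top"
    using c by real_asymp
  moreover have "eventually (\<lambda>n. (c * n - K * sqrt n) / ln (4 * n) - 2 * sqrt n \<le> real (P n)) at_top"
    using eventually_ge_at_top[of 30] by eventually_elim (use lower in simp)
  ultimately have "filterlim (\<lambda>n. real (P n)) at_top at_top"
    by (rule filterlim_at_top_mono)
  then have lim: "filterlim P at_top at_top"
    by (simp add: filterlim_sequentially_iff_filterlim_real)
  moreover have "\<exists>L>0. \<forall>n\<ge>L. P n \<ge> m" for m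
  proof -
    obtain L where "\<forall>n\<ge>L. P n \<ge> m"
      using lim unfolding filterlim_at_top eventually_sequentially by blast
    then show ?thesis by (intro exI[of _ "Suc L"]) auto
  qed
  ultimately show ?thesis unfolding P_def by blast
qed

end
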